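(* There are infinitely many graphs $G$ such that $\overline{\operatorname{Z}}(G)=\operatorname{Z}(G)$ and $\overline{\operatorname{Z}}(G\vee K_1)>\operatorname{Z}(G\vee K_1)$.
   Context: All graphs are finite, simple and undirected. $G\vee K_1$ denotes the graph obtained from $G$ by adding one new vertex adjacent to every vertex of $G$ (a universal vertex). Given a set $S$ of initially blue vertices (all others white), the zero forcing color change rule says that a blue vertex with exactly one white neighbor causes that neighbor to become blue. $S$ is a zero forcing set if repeatedly applying this rule eventually makes every vertex blue. $\operatorname{Z}(G)$ is the minimum cardinality of a zero forcing set of $G$. A minimal zero forcing set is a zero forcing set containing no other zero forcing set as a proper subset, and $\overline{\operatorname{Z}}(G)$ is the maximum size of a minimal zero forcing set of $G$. *)

theory Defs
  imports "Graph_Theory.Graph_Theory"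
begin

text \<open>A finite simple undirected graph is a \<^const>\<open>pair_graph\<close>: every edge is represented by its
  two opposite arcs.\<close>

definition nbrs :: "'a pair_pre_digraph \<Rightarrow> 'a \<Rightarrow> 'a set" where
  "nbrs G u = {v. (u, v) \<in> parcs G}"

text \<open>\<open>G \<or> K\<^sub>1\<close>: the new vertex is \<^const>\<open>None\<close>, and the old vertices are tagged with
  \<^const>\<open>Some\<close>.\<close>

definition join_K1 :: "'a pair_pre_digraph \<Rightarrow> 'a option pair_pre_digraph" where
  "join_K1 G = \<lparr> pverts = insert None (Some ` pverts G),
     parcs = {(Some u, Some v) | u v. (u, v) \<in> parcs G}
       \<union> {(None, Some v) | v. v \<in> pverts G} \<union> {(Some v, None) | v. v \<in> pverts G} \<rparr>"

definition color_change :: "'a pair_pre_digraph \<Rightarrow> 'a set \<Rightarrow> 'a set \<Rightarrow> bool" where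
  "color_change G B B' \<longleftrightarrow> (\<exists>u\<in>B. \<exists>w. nbrs G u - B = {w} \<and> B' = insert w B)"

definition zero_forcing_set :: "'a pair_pre_digraph \<Rightarrow> 'a set \<Rightarrow> bool" where
  "zero_forcing_set G S \<longleftrightarrow> S \<subseteq> pverts G \<and> (color_change G)\<^sup>*\<^sup>* S (pverts G)"

definition minimal_zero_forcing_set :: "'a pair_pre_digraph \<Rightarrow> 'a set \<Rightarrow> bool" where
  "minimal_zero_forcing_set G S \<longleftrightarrow>
     zero_forcing_set G S \<and> \<not> (\<exists>T. T \<subset> S \<and> zero_forcing_set G T)"

definition zero_forcing_number :: "'a pair_pre_digraph \<Rightarrow> nat" where
  "zero_forcing_number G = Min (card ` {S. zero_forcing_set G S})"

definition upper_zero_forcing_number :: "'a pair_pre_digraph \<Rightarrow> nat" where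
  "upper_zero_forcing_number G = Max (card ` {S. minimal_zero_forcing_set G S})"

text \<open>For a finite graph, the minimum and the maximum range over finite nonempty sets.\<close>

lemma finite_zero_forcing_sets:
  assumes "finite (pverts G)"
  shows "finite {S. zero_forcing_set G S}" "finite {S. minimal_zero_forcing_set G S}"
  by (rule finite_subset[of _ "Pow (pverts G)"];
      use assms in \<open>auto simp: zero_forcing_set_def minimal_zero_forcing_set_def\<close>)+

lemma zero_forcing_set_pverts: "zero_forcing_set G (pverts G)"
  by (simp add: zero_forcing_set_def)

lemma minimal_zero_forcing_set_exists:
  assumes "finite (pverts G)"
  shows "\<exists>S. minimal_zero_forcing_set G S"
proof -
  have "{S. zero_forcing_set G S} \<noteq> {}"
    using zero_forcing_set_pverts by blast
  from finite_has_minimal[OF finite_zero_forcing_sets(1)[OF assms] this]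
  show ?thesis
    unfolding minimal_zero_forcing_set_def by blast
qed

lemma pair_graph_join_K1:
  assumes "pair_graph G"
  shows "pair_graph (join_K1 G)"
proof -
  interpret pair_graph G by fact
  have "parcs (join_K1 G) \<subseteq> pverts (join_K1 G) \<times> pverts (join_K1 G)"
    by (auto simp: join_K1_def dest: wellformed')
  then have "finite (parcs (join_K1 G))"
    by (rule finite_subset) (simp add: join_K1_def)
  moreover have "(v, u) \<in> parcs G" if "(u, v) \<in> parcs G" for u v
    using pair_sym_arcs that by (auto simp: symmetric_def dest: symD)
  ultimately show ?thesis
    by unfold_locales
      (auto simp: join_K1_def symmetric_def sym_def dest: wellformed' no_loops')
qed

end

theory Submission
  imports Defs
begin

text \<open>Attach \<open>n \<ge> 2\<close> leaves to a vertex \<open>c\<close> of a 4-cycle \<open>c x a y\<close>. Two leaves are twins, and so are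
  \<open>x\<close> and \<open>y\<close>; hence a zero forcing set contains all leaves but one and also \<open>x\<close> or \<open>y\<close>. These
  \<open>n\<close> vertices are already zero forcing, so all minimal zero forcing sets have size \<open>n\<close>.
  After the join with \<open>K\<^sub>1\<close>, the \<open>n\<close> vertices together with the universal vertex are zero forcing.
  A zero forcing set avoiding the universal vertex must contain a closed neighbourhood of the
  original graph; taking the one of \<open>a\<close>, together with all leaves but one, gives a minimal zero
  forcing set of size \<open>n + 2\<close>.\<close>

section \<open>Forcing and forts\<close>

text \<open>Lets a forcing sequence be built backwards from the full vertex set, one force of
  \<open>w\<close> by \<open>u\<close> at a time. Since \<open>w\<close> may already be blue, its
  whiteness need not be checked at each use.\<close>

lemma color_change_rtranclp_step:
  assumes "u \<in> B" "w \<in> nbrs G u" "nbrs G u \<subseteq> insert w B"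
    and "(color_change G)\<^sup>*\<^sup>* (insert w B) V"
  shows "(color_change G)\<^sup>*\<^sup>* B V"
proof (cases "w \<in> B")
  case True
  then show ?thesis using assms(4) by (simp add: insert_absorb)
next
  case False
  then have "color_change G B (insert w B)"
    using assms(1-3) unfolding color_change_def by blast
  then show ?thesis using assms(4) by (rule converse_rtranclp_into_rtranclp)
qed

text \<open>\<open>F\<close> is a fort: no vertex outside it has exactly one neighbour in it. While
  \<open>F\<close> is all white, any forcing vertex lies outside \<open>F\<close>; if it forced a
  vertex of \<open>F\<close>, that would be its only neighbour in \<open>F\<close>. So
  \<open>F\<close> stays white forever.\<close>

lemma fort_not_zero_forcing:
  assumes "F \<noteq> {}" "F \<subseteq> pverts G" "F \<inter> S = {}"
    and fort: "\<And>u w. u \<notin> F \<Longrightarrow> nbrs G u \<inter> F \<noteq> {w}"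
  shows "\<not> zero_forcing_set G S"
proof
  assume "zero_forcing_set G S"
  then have "(color_change G)\<^sup>*\<^sup>* S (pverts G)"
    by (simp add: zero_forcing_set_def)
  then have "F \<inter> pverts G = {}"
  proof (induction rule: rtranclp_induct)
    case base
    then show ?case by fact
  next
    case (step B B')
    then obtain u w where uw: "u \<in> B" "nbrs G u - B = {w}" "B' = insert w B"
      unfolding color_change_def by blast
    have "w \<notin> F"
    proof
      assume "w \<in> F"
      then have "nbrs G u \<inter> F = {w}" using uw step.IH by blast
      then show False using fort uw(1) step.IH by blast
    qed
    then show ?case using uw step.IH by blast
  qed
  then show False using assms(1,2) by blast
qed

text \<open>Every vertex sees both twins or neither, so \<open>{u, v}\<close> is a fort.\<close>

lemma twins_zero_forcing:
  assumes "zero_forcing_set G S" "u \<in> pverts G" "v \<in> pverts G" "u \<noteq> v"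
    and "\<And>w. u \<in> nbrs G w \<longleftrightarrow> v \<in> nbrs G w"
  shows "u \<in> S \<or> v \<in> S"
proof (rule ccontr)
  assume "\<not> (u \<in> S \<or> v \<in> S)"
  then have disj: "{u, v} \<inter> S = {}" by blast
  have "nbrs G t \<inter> {u, v} \<noteq> {w}" for t w
    using assms(4) assms(5)[of t] by (cases "u \<in> nbrs G t") auto
  then have "\<not> zero_forcing_set G S"
    using assms(2,3) disj by (intro fort_not_zero_forcing[of "{u, v}"]) auto
  then show False using assms(1) by blast
qed

lemma twin_class_zero_forcing:
  assumes "zero_forcing_set G S" "L \<subseteq> pverts G" "L \<noteq> {}"
    and "\<And>u v w. u \<in> L \<Longrightarrow> v \<in> L \<Longrightarrow> u \<in> nbrs G w \<longleftrightarrow> v \<in> nbrs G w"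
  shows "\<exists>l\<in>L. L - {l} \<subseteq> S"
proof (cases "L \<subseteq> S")
  case True
  then show ?thesis using assms(3) by blast
next
  case False
  then obtain l where l: "l \<in> L" "l \<notin> S" by blast
  have "u \<in> S" if "u \<in> L - {l}" for u
    using twins_zero_forcing[OF assms(1), of u l] assms(2,4) l that by blast
  then show ?thesis using l by blast
qed

text \<open>A minimal set equals the subset of size \<open>k\<close> that it contains, and no zero
  forcing set is smaller than \<open>k\<close>. A minimal set exists, so \<open>k\<close> is
  attained in both extrema.\<close>

lemma zero_forcing_numbers_eqI:
  assumes fin: "finite (pverts G)"
    and sub: "\<And>S. zero_forcing_set G S \<Longrightarrow> \<exists>T\<subseteq>S. zero_forcing_set G T \<and> card T = k"
  shows "zero_forcing_number G = k" "upper_zero_forcing_number G = k"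
proof -
  have ge: "k \<le> card S" if S: "zero_forcing_set G S" for S
  proof -
    have "finite S" using S fin unfolding zero_forcing_set_def by (blast intro: finite_subset)
    then show ?thesis using sub[OF S] card_mono by blast
  qed
  have eq: "card S = k" if "minimal_zero_forcing_set G S" for S
    using that sub[of S] unfolding minimal_zero_forcing_set_def by blast
  obtain M where M: "minimal_zero_forcing_set G M"
    using minimal_zero_forcing_set_exists[OF fin] by blast
  then have M': "zero_forcing_set G M" by (simp add: minimal_zero_forcing_set_def)
  have k: "k \<in> card ` {S. zero_forcing_set G S}" "k \<in> card ` {S. minimal_zero_forcing_set G S}"
    using M M' eq[OF M] by blast+
  show "zero_forcing_number G = k"
    unfolding zero_forcing_number_def
    by (rule Min_eqI) (use finite_zero_forcing_sets(1)[OF fin] ge k in auto)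
  show "upper_zero_forcing_number G = k"
    unfolding upper_zero_forcing_number_def
    by (rule Max_eqI) (use finite_zero_forcing_sets(2)[OF fin] eq k in auto)
qed

lemma zero_forcing_number_le:
  assumes "finite (pverts G)" "zero_forcing_set G S"
  shows "zero_forcing_number G \<le> card S"
  unfolding zero_forcing_number_def
  by (rule Min_le) (use assms finite_zero_forcing_sets(1) in auto)

lemma upper_zero_forcing_number_ge:
  assumes "finite (pverts G)" "minimal_zero_forcing_set G S"
  shows "card S \<le> upper_zero_forcing_number G"
  unfolding upper_zero_forcing_number_def
  by (rule Max_ge) (use assms finite_zero_forcing_sets(2) in auto)

lemma pverts_join_K1: "pverts (join_K1 G) = insert None (Some ` pverts G)"
  by (simp add: join_K1_def)

lemma nbrs_join_K1_None: "nbrs (join_K1 G) None = Some ` pverts G"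
  by (auto simp: nbrs_def join_K1_def)

lemma nbrs_join_K1_Some:
  "nbrs (join_K1 G) (Some v) = Some ` nbrs G v \<union> (if v \<in> pverts G then {None} else {})"
  by (auto simp: nbrs_def join_K1_def)

section \<open>The 4-cycle with leaves\<close>

text \<open>In the notation above, \<open>c = 0\<close>, \<open>a = 1\<close>, \<open>x = 2\<close> and \<open>y = 3\<close>.\<close>

abbreviation leaves :: "nat \<Rightarrow> nat set" where
  "leaves n \<equiv> {4..<n + 4}"

text \<open>The 4-cycle is the complete bipartite graph between \<open>{0, 1}\<close> and
  \<open>{2, 3}\<close>. \<open>E\<close> holds one arc per edge, and its converse supplies the
  other.\<close>

definition square_with_leaves :: "nat \<Rightarrow> nat pair_pre_digraph" where
  "square_with_leaves n =
     (let E = {0, 1} \<times> {2, 3} \<union> {0} \<times> leaves n in \<lparr> pverts = {..<n + 4}, parcs = E \<union> E\<inverse> \<rparr>)"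

lemma pverts_square_with_leaves: "pverts (square_with_leaves n) = {0, 1, 2, 3} \<union> leaves n"
  by (auto simp: square_with_leaves_def Let_def)

lemma card_pverts_square_with_leaves: "card (pverts (square_with_leaves n)) = n + 4"
  by (simp add: square_with_leaves_def Let_def)

lemma nbrs_square_with_leaves:
  "nbrs (square_with_leaves n) u =
     (if u = 0 then {2, 3} \<union> leaves n else if u = 1 then {2, 3}
      else if u = 2 \<or> u = 3 then {0, 1} else if u \<in> leaves n then {0} else {})"
  by (auto simp: nbrs_def square_with_leaves_def Let_def)

lemma pair_graph_square_with_leaves: "pair_graph (square_with_leaves n)"
  by unfold_locales (auto simp: square_with_leaves_def Let_def symmetric_def sym_def)

context
  fixes n :: nat
  assumes n: "n \<ge> 2"
begin

private abbreviation (input) "G \<equiv> square_with_leaves n"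

private lemma another_leaf: "\<exists>m\<in>leaves n. m \<noteq> l"
proof (cases "l = 4")
  case True
  then show ?thesis using n by (intro bexI[of _ 5]) auto
next
  case False
  then show ?thesis using n by (intro bexI[of _ 4]) auto
qed

private lemma card_leaves_remove:
  assumes "l \<in> leaves n"
  shows "card (leaves n - {l}) = n - 1"
  using assms by simp

private lemma zero_forcing_set_square:
  assumes l: "l \<in> leaves n" and x: "x \<in> {2, 3}"
  shows "zero_forcing_set G (insert x (leaves n - {l}))"
proof -
  \<comment> \<open>Here two leaves are needed. The forces, established below in reverse order, are:
    \<open>m\<close> forces \<open>0\<close>, \<open>x\<close> forces \<open>1\<close>,
    \<open>1\<close> forces the other one of \<open>2\<close> and \<open>3\<close>, and
    \<open>0\<close> forces \<open>l\<close>.\<close>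
  obtain m where m: "m \<in> leaves n" "m \<noteq> l" using another_leaf by blast
  let ?B = "insert x (leaves n - {l})"
  let ?B' = "insert 2 (insert 3 (insert 1 (insert 0 ?B)))"
  have "insert l ?B' = pverts G"
    using l x by (auto simp: pverts_square_with_leaves)
  then have "(color_change G)\<^sup>*\<^sup>* (insert l ?B') (pverts G)" by simp
  then have "(color_change G)\<^sup>*\<^sup>* ?B' (pverts G)"
    by (rule color_change_rtranclp_step[of 0, rotated 3])
      (use l in \<open>auto simp: nbrs_square_with_leaves\<close>)
  \<comment> \<open>\<open>5 - x\<close> is the element of \<open>{2, 3}\<close> other than
    \<open>x\<close>.\<close>
  then have "(color_change G)\<^sup>*\<^sup>* (insert (5 - x) (insert 1 (insert 0 ?B))) (pverts G)"
    using x by (auto simp: insert_commute)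
  then have "(color_change G)\<^sup>*\<^sup>* (insert 1 (insert 0 ?B)) (pverts G)"
    by (rule color_change_rtranclp_step[of 1, rotated 3])
      (use x in \<open>auto simp: nbrs_square_with_leaves\<close>)
  then have "(color_change G)\<^sup>*\<^sup>* (insert 0 ?B) (pverts G)"
    by (rule color_change_rtranclp_step[of x, rotated 3])
      (use x in \<open>auto simp: nbrs_square_with_leaves\<close>)
  then have "(color_change G)\<^sup>*\<^sup>* ?B (pverts G)"
    by (rule color_change_rtranclp_step[of m, rotated 3])
      (use m in \<open>auto simp: nbrs_square_with_leaves\<close>)
  then show ?thesis
    using x by (auto simp: zero_forcing_set_def pverts_square_with_leaves)
qed

private lemma zero_forcing_numbers_square:
  "zero_forcing_number G = n" "upper_zero_forcing_number G = n"
proof -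
  have fin: "finite (pverts G)" by (simp add: pverts_square_with_leaves)
  have sub: "\<exists>T\<subseteq>S. zero_forcing_set G T \<and> card T = n" if S: "zero_forcing_set G S" for S
  proof -
    have "\<exists>l\<in>leaves n. leaves n - {l} \<subseteq> S"
      by (rule twin_class_zero_forcing[OF S])
        (use n in \<open>auto simp: pverts_square_with_leaves nbrs_square_with_leaves\<close>)
    then obtain l where l: "l \<in> leaves n" "leaves n - {l} \<subseteq> S" by blast
    have "2 \<in> S \<or> 3 \<in> S"
      by (rule twins_zero_forcing[OF S])
        (auto simp: pverts_square_with_leaves nbrs_square_with_leaves)
    then obtain x where x: "x \<in> {2, 3}" "x \<in> S" by blast
    have "x \<notin> leaves n" using x by auto
    then have "card (insert x (leaves n - {l})) = n"
      using card_leaves_remove[OF l(1)] n by (subst card_insert_disjoint) auto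
    then show ?thesis
      using zero_forcing_set_square[OF l(1) x(1)] l(2) x(2)
      by (intro exI[of _ "insert x (leaves n - {l})"]) blast
  qed
  show "zero_forcing_number G = n" "upper_zero_forcing_number G = n"
    using zero_forcing_numbers_eqI[OF fin sub] by blast+
qed

section \<open>The join with a universal vertex\<close>

private abbreviation (input) "J \<equiv> join_K1 G"

private lemma finite_pverts_join: "finite (pverts J)"
  by (simp add: pverts_join_K1 pverts_square_with_leaves)

private lemmas join_simps = pverts_join_K1 nbrs_join_K1_None nbrs_join_K1_Some
  pverts_square_with_leaves nbrs_square_with_leaves

private lemma zero_forcing_number_join_le: "zero_forcing_number J \<le> n + 1"
proof -
  \<comment> \<open>With \<open>None\<close> blue, the forces are those of the original graph, for
    \<open>x = 2\<close>, \<open>l = 4\<close> and \<open>m = 5\<close>.\<close>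
  let ?B = "insert None (Some ` insert 2 (leaves n - {4}))"
  have "insert (Some 4) (insert (Some 3) (insert (Some 1) (insert (Some 0) ?B))) = pverts J"
    using n by (auto simp: join_simps)
  then have "(color_change J)\<^sup>*\<^sup>*
      (insert (Some 4) (insert (Some 3) (insert (Some 1) (insert (Some 0) ?B)))) (pverts J)" by simp
  then have "(color_change J)\<^sup>*\<^sup>* (insert (Some 3) (insert (Some 1) (insert (Some 0) ?B))) (pverts J)"
    by (rule color_change_rtranclp_step[of "Some 0", rotated 3]) (use n in \<open>auto simp: join_simps\<close>)
  then have "(color_change J)\<^sup>*\<^sup>* (insert (Some 1) (insert (Some 0) ?B)) (pverts J)"
    by (rule color_change_rtranclp_step[of "Some 1", rotated 3]) (auto simp: join_simps)
  then have "(color_change J)\<^sup>*\<^sup>* (insert (Some 0) ?B) (pverts J)"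
    by (rule color_change_rtranclp_step[of "Some 2", rotated 3]) (auto simp: join_simps)
  then have "(color_change J)\<^sup>*\<^sup>* ?B (pverts J)"
    by (rule color_change_rtranclp_step[of "Some 5", rotated 3]) (use n in \<open>auto simp: join_simps\<close>)
  then have "zero_forcing_set J ?B"
    by (auto simp: zero_forcing_set_def join_simps)
  moreover have "card ?B = n + 1"
    using n by (simp add: card_image card_insert_if image_iff del: image_insert)
  ultimately show ?thesis
    using zero_forcing_number_le[OF finite_pverts_join] by metis
qed

private lemma upper_zero_forcing_number_join_ge: "n + 2 \<le> upper_zero_forcing_number J"
proof -
  \<comment> \<open>\<open>{1, 2, 3}\<close> is the closed neighbourhood of \<open>1\<close>, so
    \<open>1\<close> can force \<open>None\<close>. Then \<open>5\<close> forces \<open>0\<close>,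
    and \<open>0\<close> forces \<open>4\<close>.\<close>
  let ?S = "Some ` ({1, 2, 3} \<union> (leaves n - {4}))"
  have "insert (Some 4) (insert (Some 0) (insert None ?S)) = pverts J"
    using n by (auto simp: join_simps)
  then have "(color_change J)\<^sup>*\<^sup>* (insert (Some 4) (insert (Some 0) (insert None ?S))) (pverts J)"
    by simp
  then have "(color_change J)\<^sup>*\<^sup>* (insert (Some 0) (insert None ?S)) (pverts J)"
    by (rule color_change_rtranclp_step[of "Some 0", rotated 3]) (use n in \<open>auto simp: join_simps\<close>)
  then have "(color_change J)\<^sup>*\<^sup>* (insert None ?S) (pverts J)"
    by (rule color_change_rtranclp_step[of "Some 5", rotated 3]) (use n in \<open>auto simp: join_simps\<close>)
  then have "(color_change J)\<^sup>*\<^sup>* ?S (pverts J)"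
    by (rule color_change_rtranclp_step[of "Some 1", rotated 3]) (auto simp: join_simps)
  then have "zero_forcing_set J ?S"
    by (auto simp: zero_forcing_set_def join_simps)
  moreover have "\<not> zero_forcing_set J T" if T: "T \<subset> ?S" for T
  \<comment> \<open>If \<open>T\<close> lacks a leaf besides \<open>4\<close>, two twin leaves are
    white. Otherwise \<open>T\<close> lacks one of \<open>1\<close>, \<open>2\<close>,
    \<open>3\<close>, and it is stuck from the start.\<close>
  proof (cases "Some ` (leaves n - {4}) \<subseteq> T")
    case False
    then obtain l where l: "l \<in> leaves n" "l \<noteq> 4" "Some l \<notin> T" by blast
    have "Some 4 \<notin> T" using T by auto
    then show ?thesis
      using twins_zero_forcing[of J T "Some l" "Some 4"] l n
      by (auto simp: nbrs_def join_K1_def square_with_leaves_def Let_def)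
  next
    case True
    have white: "None \<notin> T" "Some 0 \<notin> T" using T by auto
    \<comment> \<open>This blocks the vertex \<open>1\<close>: if it is in \<open>T\<close>, then
      \<open>2\<close> or \<open>3\<close> is white. Leaves, \<open>2\<close> and \<open>3\<close>
      are blocked by their white neighbour \<open>0\<close>.\<close>
    have "\<not> {Some 1, Some 2, Some 3} \<subseteq> T" using True T by auto
    \<comment> \<open>No vertex of \<open>T\<close> can force: its closed neighbourhood in \<open>G\<close> is not contained in \<open>T\<close>,
      and the universal vertex is white too.\<close>
    then have stuck: "\<exists>v. Some v \<in> nbrs J u \<and> Some v \<notin> T" if "u \<in> T" for u
      using that T white by (fastforce simp: join_simps)
    show ?thesis
    \<comment> \<open>The set of all white vertices is a fort, as each vertex of \<open>T\<close>
      has two white neighbours: \<open>None\<close> and some \<open>Some v\<close>.\<close>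
    proof (rule fort_not_zero_forcing[of "pverts J - T"])
      show "pverts J - T \<noteq> {}" using white by (auto simp: join_simps)
    next
      fix u w assume u: "u \<notin> pverts J - T"
      show "nbrs J u \<inter> (pverts J - T) \<noteq> {w}"
      proof (cases "u \<in> T")
        case False
        \<comment> \<open>The fort condition ranges over the whole type, so \<open>u\<close> may lie
          outside the graph.\<close>
        then have "nbrs J u = {}"
          using u by (cases u) (auto simp: join_simps)
        then show ?thesis by simp
      next
        case True
        then obtain v where v: "Some v \<in> nbrs J u" "Some v \<notin> T" using stuck by blast
        have "Some v \<in> pverts J" using v(1) by (cases u) (auto simp: join_simps split: if_splits)
        then have "Some v \<in> nbrs J u \<inter> (pverts J - T)" using v by blast
        moreover have "None \<in> nbrs J u \<inter> (pverts J - T)"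
          using True T white by (auto simp: join_simps)
        ultimately show ?thesis by (metis option.distinct(1) singletonD)
      qed
    qed auto
  qed
  ultimately have "minimal_zero_forcing_set J ?S"
    unfolding minimal_zero_forcing_set_def by blast
  moreover have "card ?S = n + 2"
  proof -
    have "card ({1, 2, 3} \<union> (leaves n - {4})) = 3 + (n - 1)"
      by (subst card_Un_disjoint) (use n in auto)
    then show ?thesis using n by (subst card_image) auto
  qed
  ultimately show ?thesis
    using upper_zero_forcing_number_ge[OF finite_pverts_join] by metis
qed

lemma square_with_leaves_zero_forcing:
  "upper_zero_forcing_number (square_with_leaves n) = zero_forcing_number (square_with_leaves n)"
  "upper_zero_forcing_number (join_K1 (square_with_leaves n))
     > zero_forcing_number (join_K1 (square_with_leaves n))"
  using zero_forcing_numbers_square zero_forcing_number_join_le upper_zero_forcing_number_join_ge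
  by simp_all

end

section \<open>Infinitely many pairwise non-isomorphic examples\<close>

lemma digraph_iso_square_with_leavesD:
  assumes "digraph_iso (with_proj (square_with_leaves m)) (with_proj (square_with_leaves n))"
  shows "m = n"
proof -
  interpret pair_graph "square_with_leaves m" by (rule pair_graph_square_with_leaves)
  obtain h where h: "digraph_isomorphism h"
    "with_proj (square_with_leaves n) = app_iso h (with_proj (square_with_leaves m))"
    using assms unfolding digraph_iso_def by blast
  \<comment> \<open>An isomorphism is a bijection on vertices, so the orders \<open>m + 4\<close>
    and \<open>n + 4\<close> agree.\<close>
  have "inj_on (iso_verts h) (pverts (square_with_leaves m))"
    using h(1) unfolding digraph_isomorphism_def by simp
  moreover have "pverts (square_with_leaves n) = iso_verts h ` pverts (square_with_leaves m)"
    using arg_cong[OF h(2), of verts] by simp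
  ultimately show ?thesis
    using card_pverts_square_with_leaves by (metis card_image add_right_cancel)
qed

theorem theorem3p5:
  shows "\<exists>\<G> :: nat pair_pre_digraph set.
    infinite \<G> \<and>
    pairwise (\<lambda>G H. \<not> digraph_iso (with_proj G) (with_proj H)) \<G> \<and>
    (\<forall>G\<in>\<G>. pair_graph G \<and>
       upper_zero_forcing_number G = zero_forcing_number G \<and>
       upper_zero_forcing_number (join_K1 G) > zero_forcing_number (join_K1 G))"
proof (intro exI[of _ "square_with_leaves ` {2..}"] conjI)
  have "inj square_with_leaves"
    by (rule injI) (metis card_pverts_square_with_leaves add_right_cancel)
  then show "infinite (square_with_leaves ` {2..})"
    by (metis finite_imageD infinite_Ici inj_on_subset subset_UNIV)
  show "pairwise (\<lambda>G H. \<not> digraph_iso (with_proj G) (with_proj H)) (square_with_leaves ` {2..})"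
    by (auto simp: pairwise_def dest: digraph_iso_square_with_leavesD)
qed (auto simp: pair_graph_square_with_leaves square_with_leaves_zero_forcing)

end
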